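(* Let $F$ be a tract with an involution $x\mapsto\overline{x}$. Let $\mathcal{C}$ be a strong (resp. weak) orthogonal $F$-signature of an orthogonal matroid $\underline{M}$ on $E=[n]\cup[n]^*$ and let $e\in E$. Then $\mathcal{C}|e$ is a strong (resp. weak) orthogonal $F$-signature of $\underline{M}|e$.
   Context: **Tracts.** A tract $F=(G,N_F)$ is an abelian group $G$ (written multiplicatively) with a subset $N_F$ of the group semiring $\mathbb{N}[G]$ such that: $0\in N_F$; $1\notin N_F$; there is a unique $\epsilon\in G$ with $1+\epsilon\in N_F$; and $g\in G$, $a\in N_F$ imply $ga\in N_F$. Write $F$ also for $G\cup\{0\}$ (with $0\cdot x=0$), $F^\times=G$; formal sums of elements of $F$ are regarded as elements of $\mathbb{N}[G]$. A tract homomorphism $F_1\to F_2$ is a group homomorphism $F_1^\times\to F_2^\times$ (extended by $0\mapsto0$) whose induced map $\mathbb{N}[F_1^\times]\to\mathbb{N}[F_2^\times]$ sends $N_{F_1}$ into $N_{F_2}$; an involution of $F$ is a tract homomorphism $F\to F$ whose square is the identity. **Orthogonal matroids.** For a finite set $S$ of positive integers let $E_S=S\cup S^*$ with involution $*$ exchanging $s$ and $s^*$; $E=E_{[n]}$, and $E\setminus\{e,e^*\}=E_S$ with $S=[n]\setminus\{e,e^*\}$. A subset $A$ of $E_S$ is admissible if $A\cap A^*=\emptyset$; a transversal is an admissible set with $|S|$ elements; $\triangle$ is symmetric difference. An orthogonal matroid on $E_S$ is a pair $\underline{M}=(E_S,\mathcal{B})$ with $\mathcal{B}$ a nonempty set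 of transversals (bases) such that for $B_1,B_2\in\mathcal{B}$ and every $\{x_1,x_1^*\}\subseteq B_1\triangle B_2$ there is $\{x_2,x_2^*\}\subseteq B_1\triangle B_2$ with $\{x_2,x_2^*\}\neq\{x_1,x_1^*\}$ and $B_1\triangle\{x_1,x_1^*,x_2,x_2^*\}\in\mathcal{B}$. A circuit is an inclusion-minimal admissible subset not contained in a basis. An element $e$ is singular if no basis contains $e$, nonsingular otherwise (if $e$ is singular, $e^*$ is nonsingular). For $e$ nonsingular, $\underline{M}|e$ is the orthogonal matroid on $E_S\setminus\{e,e^*\}$ with bases $\{B\setminus\{e\}:e\in B\in\mathcal{B}\}$; for $e$ singular, $\underline{M}|e:=\underline{M}|e^*$. **Signatures.** For $X\in F^{E_S}$: $\underline{X}=\{i:X(i)\neq0\}$; $X^*(i)=X(i^* )$; $\tilde X(i)=X(i)$ for $i\in S$ and $\tilde X(i)=\overline{X(i)}$ for $i\in S^*$; $\langle X,Y\rangle=\sum_{i\in S}(X(i)\overline{Y(i)}+\overline{X(i^* )}Y(i^* ))$, so $\langle X,Y^*\rangle=\sum_{i\in E_S}\tilde X(i)\tilde Y(i^* )$. For $\alpha\in F^\times$, $\alpha\cdot X$ denotes the vector with $\widetilde{\alpha\cdot X}=\alpha\tilde X$. An $F$-signature of $\underline{M}$ is a set $\mathcal{C}\subseteq F^{E_S}$ such that $\{\underline{X}:X\in\mathcal{C}\}$ is the set of circuits of $\underline{M}$ and $\alpha\cdot X\in\mathcal{C}$ for all $X\in\mathcal{C}$, $\alpha\in F^\times$. It is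 a strong orthogonal $F$-signature if $\langle X,Y^*\rangle\in N_F$ for all $X,Y\in\mathcal{C}$, and a weak orthogonal $F$-signature if this holds for all $X,Y\in\mathcal{C}$ with $|\underline{X}\cap\underline{Y}^*|\leq4$. **Minor of a signature.** For $e\in E$, $\mathcal{C}|e$ is the set of those elements of $\{\pi(X)\in F^{E\setminus\{e,e^*\}}:X\in\mathcal{C},\ X(e^* )=0,\ \underline{X}\neq\{e\}\}$ that have inclusion-minimal support within this set, where $\pi:F^E\to F^{E\setminus\{e,e^*\}}$ is the coordinate projection. *)

theory Defs
  imports "HOL-Algebra.Group" "HOL-Library.Multiset" "HOL-Library.FuncSet"
begin

section \<open>Tracts\<close>

text \<open>
  An element of the group semiring \<open>\<nat>[G]\<close> is a formal sum of elements of \<open>G\<close> with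
  coefficients in \<open>\<nat>\<close>; it is represented as a finite multiset over the carrier. Thus
  \<open>{#}\<close> is \<open>0\<close>, \<open>{#g#}\<close> is the group element \<open>g\<close>, multiset union is addition, and the product
  of \<open>g\<close> with a formal sum is the image of the multiset under left multiplication by \<open>g\<close>.
\<close>

record 'g tract = "'g monoid" +
  null_set :: "'g multiset set"

definition group_semiring :: "'g tract \<Rightarrow> 'g multiset set" where
  "group_semiring F = {a. set_mset a \<subseteq> carrier F}"

locale tract = comm_group F for F :: "'g tract" (structure) +
  assumes null_set_subset: "null_set F \<subseteq> group_semiring F"
    and zero_null: "{#} \<in> null_set F"
    and one_not_null: "{#\<one>#} \<notin> null_set F"
    and unique_epsilon: "\<exists>!\<epsilon>. \<epsilon> \<in> carrier F \<and> {#\<one>, \<epsilon>#} \<in> null_set F"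
    and null_scale: "\<lbrakk>g \<in> carrier F; a \<in> null_set F\<rbrakk> \<Longrightarrow> image_mset (\<lambda>x. g \<otimes> x) a \<in> null_set F"

definition tract_hom :: "'g tract \<Rightarrow> 'h tract \<Rightarrow> ('g \<Rightarrow> 'h) \<Rightarrow> bool" where
  "tract_hom F1 F2 h \<longleftrightarrow> h \<in> hom F1 F2 \<and> (\<forall>a \<in> null_set F1. image_mset h a \<in> null_set F2)"

definition tract_involution :: "'g tract \<Rightarrow> ('g \<Rightarrow> 'g) \<Rightarrow> bool" where
  "tract_involution F bar \<longleftrightarrow> tract_hom F F bar \<and> (\<forall>x \<in> carrier F. bar (bar x) = x)"

text \<open>
  The set \<open>G \<union> {0}\<close>: the adjoined \<open>0\<close> is \<open>None\<close>. A map on \<open>G\<close> is extended by \<open>0 \<mapsto> 0\<close>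
  via \<^const>\<open>map_option\<close>.
\<close>

definition with_zero :: "'g tract \<Rightarrow> 'g option set" where
  "with_zero F = insert None (Some ` carrier F)"

fun mult0 :: "'g tract \<Rightarrow> 'g option \<Rightarrow> 'g option \<Rightarrow> 'g option" where
  "mult0 F (Some x) (Some y) = Some (x \<otimes>\<^bsub>F\<^esub> y)"
| "mult0 F _ _ = None"

fun formal :: "'g option \<Rightarrow> 'g multiset" where
  "formal None = {#}"
| "formal (Some x) = {#x#}"


section \<open>Orthogonal matroids\<close>

text \<open>
  For a finite set \<open>S\<close> of positive integers, \<open>s\<^sup>*\<close> is represented by \<open>- s\<close>. Hence \<open>e\<^sup>*\<close> is \<open>- e\<close>
  for every \<open>e\<close> in \<open>E\<^sub>S\<close>, \<open>A\<^sup>*\<close> is \<open>uminus ` A\<close>, and \<open>E\<^sub>S\<close> without \<open>e, e\<^sup>*\<close> is the ground set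
  of \<open>S - {e, - e}\<close>. An orthogonal matroid on \<open>E\<^sub>S\<close> is given by \<open>S\<close> and its set of bases \<open>\<B>\<close>.
\<close>

definition ground :: "int set \<Rightarrow> int set" where
  "ground S = S \<union> uminus ` S"

definition admissible :: "int set \<Rightarrow> int set \<Rightarrow> bool" where
  "admissible S A \<longleftrightarrow> A \<subseteq> ground S \<and> A \<inter> uminus ` A = {}"

definition transversal :: "int set \<Rightarrow> int set \<Rightarrow> bool" where
  "transversal S A \<longleftrightarrow> admissible S A \<and> card A = card S"

definition orthogonal_matroid :: "int set \<Rightarrow> int set set \<Rightarrow> bool" where
  "orthogonal_matroid S \<B> \<longleftrightarrow>
     finite S \<and> S \<subseteq> {0<..} \<and> \<B> \<noteq> {} \<and> (\<forall>B \<in> \<B>. transversal S B) \<and>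
     (\<forall>B1 \<in> \<B>. \<forall>B2 \<in> \<B>. \<forall>x1. {x1, - x1} \<subseteq> sym_diff B1 B2 \<longrightarrow>
        (\<exists>x2. {x2, - x2} \<subseteq> sym_diff B1 B2 \<and> {x2, - x2} \<noteq> {x1, - x1} \<and>
              sym_diff B1 {x1, - x1, x2, - x2} \<in> \<B>))"

definition circuit :: "int set \<Rightarrow> int set set \<Rightarrow> int set \<Rightarrow> bool" where
  "circuit S \<B> A \<longleftrightarrow>
     admissible S A \<and> (\<nexists>B. B \<in> \<B> \<and> A \<subseteq> B) \<and>
     (\<forall>A'. admissible S A' \<and> (\<nexists>B. B \<in> \<B> \<and> A' \<subseteq> B) \<and> A' \<subseteq> A \<longrightarrow> A' = A)"

definition singular :: "int set set \<Rightarrow> int \<Rightarrow> bool" where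
  "singular \<B> e \<longleftrightarrow> (\<nexists>B. B \<in> \<B> \<and> e \<in> B)"

text \<open>The bases of the minor at \<open>e\<close>; its index set is \<open>S - {e, - e}\<close>.\<close>

definition minor_bases :: "int set set \<Rightarrow> int \<Rightarrow> int set set" where
  "minor_bases \<B> e =
     (if singular \<B> e then {B - {- e} | B. B \<in> \<B> \<and> - e \<in> B}
      else {B - {e} | B. B \<in> \<B> \<and> e \<in> B})"

lemma ground_minor:
  "ground S - {e, - e} = ground (S - {e, - e})"
  unfolding ground_def by force

lemma not_singular_minus:
  assumes M: "orthogonal_matroid S \<B>" and e: "e \<in> ground S" and s: "singular \<B> e"
  shows "\<not> singular \<B> (- e)"
proof
  assume s': "singular \<B> (- e)"
  obtain B where B: "B \<in> \<B>" using M by (auto simp: orthogonal_matroid_def)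
  have fin: "finite S" and pos: "S \<subseteq> {0<..}" and tr: "transversal S B"
    using M B by (auto simp: orthogonal_matroid_def)
  have nB: "e \<notin> B" "- e \<notin> B" using s s' B by (auto simp: singular_def)
  have adm: "B \<subseteq> ground S" "B \<inter> uminus ` B = {}" and card: "card B = card S"
    using tr by (auto simp: transversal_def admissible_def)
  have inj: "inj_on abs B"
  proof (rule inj_onI)
    fix x y assume "x \<in> B" "y \<in> B" "\<bar>x\<bar> = \<bar>y\<bar>"
    then show "x = y" using adm(2) by (auto simp: abs_eq_iff)
  qed
  have sub: "abs ` B \<subseteq> S - {\<bar>e\<bar>}"
  proof
    fix a assume "a \<in> abs ` B"
    then obtain x where x: "x \<in> B" "a = \<bar>x\<bar>" by auto
    have "\<bar>x\<bar> \<in> S" using x(1) adm(1) pos by (force simp: ground_def)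
    moreover have "\<bar>x\<bar> \<noteq> \<bar>e\<bar>" using x(1) nB by (auto simp: abs_eq_iff)
    ultimately show "a \<in> S - {\<bar>e\<bar>}" using x(2) by simp
  qed
  have eS: "\<bar>e\<bar> \<in> S" using e pos by (force simp: ground_def)
  have "card B = card (abs ` B)" using inj by (simp add: card_image)
  also have "\<dots> \<le> card (S - {\<bar>e\<bar>})" using sub fin by (intro card_mono) auto
  also have "\<dots> < card S" using fin eS by (meson card_Diff1_less)
  finally show False using card by simp
qed

text \<open>Well-definedness: the minor is again an orthogonal matroid.\<close>

lemma orthogonal_matroid_minor_aux:
  assumes M: "orthogonal_matroid S \<B>" and e: "e \<in> ground S" and ns: "\<not> singular \<B> e"
  shows "orthogonal_matroid (S - {e, - e}) {B - {e} | B. B \<in> \<B> \<and> e \<in> B}" (is "orthogonal_matroid ?S ?\<B>")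
  unfolding orthogonal_matroid_def
proof (intro conjI ballI allI impI)
  have fin: "finite S" and pos: "S \<subseteq> {0<..}" using M by (auto simp: orthogonal_matroid_def)
  show "finite ?S" "?S \<subseteq> {0<..}" using fin pos by auto
  show "?\<B> \<noteq> {}" using ns by (auto simp: singular_def)
next
  fix B' assume "B' \<in> ?\<B>"
  then obtain B where B: "B \<in> \<B>" "e \<in> B" "B' = B - {e}" by auto
  have fin: "finite S" and pos: "S \<subseteq> {0<..}" and tr: "transversal S B"
    using M B by (auto simp: orthogonal_matroid_def)
  have adm: "B \<subseteq> ground S" "B \<inter> uminus ` B = {}" and card: "card B = card S"
    using tr by (auto simp: transversal_def admissible_def)
  have ne: "- e \<notin> B" using adm(2) B(2) by force
  have "card (B - {e}) = card S - 1" using B(2) card by (simp add: card_Diff_singleton)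
  moreover have "?S = S - {\<bar>e\<bar>}" using pos by (auto simp: abs_if)
  moreover have "\<bar>e\<bar> \<in> S" using e pos by (force simp: ground_def)
  ultimately have "card (B - {e}) = card ?S" by (simp add: card_Diff_singleton)
  moreover have "B - {e} \<subseteq> ground ?S"
    using adm(1) ne by (subst ground_minor[symmetric]) auto
  ultimately show "transversal ?S B'"
    using adm(2) by (auto simp: transversal_def admissible_def B(3))
next
  fix B1' B2' x1
  assume "B1' \<in> ?\<B>" "B2' \<in> ?\<B>" and x1: "{x1, - x1} \<subseteq> sym_diff B1' B2'"
  then obtain B1 B2 where B: "B1 \<in> \<B>" "e \<in> B1" "B1' = B1 - {e}" "B2 \<in> \<B>" "e \<in> B2" "B2' = B2 - {e}"
    by auto
  have sd: "sym_diff B1' B2' = sym_diff B1 B2" using B by auto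
  have ex: "\<forall>x1. {x1, - x1} \<subseteq> sym_diff B1 B2 \<longrightarrow>
        (\<exists>x2. {x2, - x2} \<subseteq> sym_diff B1 B2 \<and> {x2, - x2} \<noteq> {x1, - x1} \<and>
              sym_diff B1 {x1, - x1, x2, - x2} \<in> \<B>)"
    using M B(1,4) unfolding orthogonal_matroid_def by blast
  obtain x2 where x2: "{x2, - x2} \<subseteq> sym_diff B1 B2" "{x2, - x2} \<noteq> {x1, - x1}"
      "sym_diff B1 {x1, - x1, x2, - x2} \<in> \<B>"
    using ex[rule_format, OF x1[unfolded sd]] by (elim exE conjE)
  have en: "e \<notin> {x1, - x1, x2, - x2}" using x1 x2(1) B(2,5) unfolding sd by auto
  have "sym_diff B1' {x1, - x1, x2, - x2} = sym_diff B1 {x1, - x1, x2, - x2} - {e}"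
    using en B(3) by auto
  moreover have "e \<in> sym_diff B1 {x1, - x1, x2, - x2}" using en B(2) by auto
  ultimately have mem: "sym_diff B1' {x1, - x1, x2, - x2} \<in> ?\<B>"
    using x2(3) by (intro CollectI exI[of _ "sym_diff B1 {x1, - x1, x2, - x2}"] conjI)
  show "\<exists>x2. {x2, - x2} \<subseteq> sym_diff B1' B2' \<and> {x2, - x2} \<noteq> {x1, - x1} \<and>
              sym_diff B1' {x1, - x1, x2, - x2} \<in> ?\<B>"
    using x2(1,2) unfolding sd[symmetric] by (intro exI[of _ x2] conjI mem)
qed

lemma orthogonal_matroid_minor:
  assumes M: "orthogonal_matroid S \<B>" and e: "e \<in> ground S"
  shows "orthogonal_matroid (S - {e, - e}) (minor_bases \<B> e)"
proof (cases "singular \<B> e")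
  case True
  have "- e \<in> ground S" using e by (auto simp: ground_def)
  from orthogonal_matroid_minor_aux[OF M this not_singular_minus[OF M e True]]
  show ?thesis using True by (simp add: minor_bases_def insert_commute)
next
  case False
  from orthogonal_matroid_minor_aux[OF M e False]
  show ?thesis using False by (simp add: minor_bases_def)
qed


section \<open>Signatures\<close>

definition vectors :: "'g tract \<Rightarrow> int set \<Rightarrow> (int \<Rightarrow> 'g option) set" where
  "vectors F S = ground S \<rightarrow>\<^sub>E with_zero F"

definition support :: "int set \<Rightarrow> (int \<Rightarrow> 'g option) \<Rightarrow> int set" where
  "support S X = {i \<in> ground S. X i \<noteq> None}"

definition star_vec :: "int set \<Rightarrow> (int \<Rightarrow> 'g option) \<Rightarrow> int \<Rightarrow> 'g option" where
  "star_vec S X = (\<lambda>i \<in> ground S. X (- i))"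

definition tilde :: "('g \<Rightarrow> 'g) \<Rightarrow> int set \<Rightarrow> (int \<Rightarrow> 'g option) \<Rightarrow> int \<Rightarrow> 'g option" where
  "tilde bar S X = (\<lambda>i \<in> ground S. if i \<in> S then X i else map_option bar (X i))"

definition pairing ::
  "'g tract \<Rightarrow> ('g \<Rightarrow> 'g) \<Rightarrow> int set \<Rightarrow> (int \<Rightarrow> 'g option) \<Rightarrow> (int \<Rightarrow> 'g option) \<Rightarrow> 'g multiset" where
  "pairing F bar S X Y =
     (\<Sum>i\<in>S. formal (mult0 F (X i) (map_option bar (Y i)))
           + formal (mult0 F (map_option bar (X (- i))) (Y (- i))))"

text \<open>
  The vector \<open>\<alpha> \<cdot> X\<close>, determined by the requirement that its tilde be \<open>\<alpha>\<close> times the tilde of \<open>X\<close>;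
  see the lemma \<open>tilde_eq_scale_iff\<close> below.
\<close>

definition scale ::
  "'g tract \<Rightarrow> ('g \<Rightarrow> 'g) \<Rightarrow> int set \<Rightarrow> 'g \<Rightarrow> (int \<Rightarrow> 'g option) \<Rightarrow> int \<Rightarrow> 'g option" where
  "scale F bar S \<alpha> X =
     (\<lambda>i \<in> ground S. mult0 F (Some (if i \<in> S then \<alpha> else bar \<alpha>)) (X i))"

lemma tilde_eq_scale_iff:
  assumes F: "tract F" and inv: "tract_involution F bar"
    and \<alpha>: "\<alpha> \<in> carrier F" and X: "X \<in> vectors F S" and Y: "Y \<in> vectors F S"
  shows "tilde bar S Y = (\<lambda>i \<in> ground S. mult0 F (Some \<alpha>) (tilde bar S X i))
     \<longleftrightarrow> Y = scale F bar S \<alpha> X"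
proof -
  have bm: "bar (x \<otimes>\<^bsub>F\<^esub> y) = bar x \<otimes>\<^bsub>F\<^esub> bar y" and bc: "bar x \<in> carrier F"
    and bb: "bar (bar x) = x" if "x \<in> carrier F" "y \<in> carrier F" for x y
    using inv that unfolding tract_involution_def tract_hom_def hom_def by auto
  have eq: "map_option bar (Y i) = mult0 F (Some \<alpha>) (map_option bar (X i))
      \<longleftrightarrow> Y i = mult0 F (Some (bar \<alpha>)) (X i)" if i: "i \<in> ground S" for i
  proof -
    have "X i \<in> with_zero F" "Y i \<in> with_zero F"
      using X Y i by (auto simp: vectors_def)
    then show ?thesis
      using \<alpha> by (auto simp: with_zero_def bm bc bb) (metis bb bc bm)+
  qed
  have ext: "Y = scale F bar S \<alpha> X \<longleftrightarrow> (\<forall>i \<in> ground S. Y i = scale F bar S \<alpha> X i)"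
    using Y by (auto simp: vectors_def PiE_def scale_def
        intro!: extensionalityI[of _ "ground S"])
  show ?thesis
    unfolding ext by (auto simp: tilde_def scale_def fun_eq_iff eq restrict_def split: if_splits)
qed

definition signature ::
  "'g tract \<Rightarrow> ('g \<Rightarrow> 'g) \<Rightarrow> int set \<Rightarrow> int set set \<Rightarrow> (int \<Rightarrow> 'g option) set \<Rightarrow> bool" where
  "signature F bar S \<B> \<C> \<longleftrightarrow>
     \<C> \<subseteq> vectors F S \<and> support S ` \<C> = {A. circuit S \<B> A} \<and>
     (\<forall>X \<in> \<C>. \<forall>\<alpha> \<in> carrier F. scale F bar S \<alpha> X \<in> \<C>)"

definition strong_orthogonal_signature ::
  "'g tract \<Rightarrow> ('g \<Rightarrow> 'g) \<Rightarrow> int set \<Rightarrow> int set set \<Rightarrow> (int \<Rightarrow> 'g option) set \<Rightarrow> bool" where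
  "strong_orthogonal_signature F bar S \<B> \<C> \<longleftrightarrow>
     signature F bar S \<B> \<C> \<and>
     (\<forall>X \<in> \<C>. \<forall>Y \<in> \<C>. pairing F bar S X (star_vec S Y) \<in> null_set F)"

definition weak_orthogonal_signature ::
  "'g tract \<Rightarrow> ('g \<Rightarrow> 'g) \<Rightarrow> int set \<Rightarrow> int set set \<Rightarrow> (int \<Rightarrow> 'g option) set \<Rightarrow> bool" where
  "weak_orthogonal_signature F bar S \<B> \<C> \<longleftrightarrow>
     signature F bar S \<B> \<C> \<and>
     (\<forall>X \<in> \<C>. \<forall>Y \<in> \<C>. card (support S X \<inter> uminus ` support S Y) \<le> 4 \<longrightarrow>
        pairing F bar S X (star_vec S Y) \<in> null_set F)"

definition minor_vectors :: "int set \<Rightarrow> (int \<Rightarrow> 'g option) set \<Rightarrow> int \<Rightarrow> (int \<Rightarrow> 'g option) set" where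
  "minor_vectors S \<C> e =
     {restrict X (ground S - {e, - e}) | X. X \<in> \<C> \<and> X (- e) = None \<and> support S X \<noteq> {e}}"

definition minor_signature :: "int set \<Rightarrow> (int \<Rightarrow> 'g option) set \<Rightarrow> int \<Rightarrow> (int \<Rightarrow> 'g option) set" where
  "minor_signature S \<C> e =
     {Z \<in> minor_vectors S \<C> e.
        \<forall>W \<in> minor_vectors S \<C> e.
          support (S - {e, - e}) W \<subseteq> support (S - {e, - e}) Z \<longrightarrow>
          support (S - {e, - e}) W = support (S - {e, - e}) Z}"

end

(* An admissible set A avoiding e and its star is dependent in the minor at e iff A contains C - {e}
   for a circuit C distinct from {e} that avoids the star of e; hence the circuits of the minor are the
   minimal sets of this form, which are exactly the minimal supports of the projected vectors. A lift X
   of such a vector has X (- e) = 0, so e and - e contribute neither to the pairing of two lifts nor to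
   the intersection of the support of one with the starred support of the other: orthogonality and the
   bound of the weak case carry over unchanged. *)

theory Submission
  imports Defs
begin

section \<open>Admissible sets, dependent sets and circuits\<close>

lemma uminus_in_ground_iff [simp]: "- i \<in> ground S \<longleftrightarrow> i \<in> ground S"
  by (force simp: ground_def)

lemma finite_ground: "finite S \<Longrightarrow> finite (ground S)"
  by (simp add: ground_def)

lemma admissible_subset: "admissible S A \<Longrightarrow> A' \<subseteq> A \<Longrightarrow> admissible S A'"
  unfolding admissible_def by blast

lemma admissible_iff: "admissible S A \<longleftrightarrow> A \<subseteq> ground S \<and> (\<forall>x\<in>A. - x \<notin> A)"
  unfolding admissible_def by force

text \<open>A minimal member of the finite family of dependent subsets of \<open>A\<close> works.
  Subsets of an admissible set are admissible, so minimality inside \<open>A\<close> is minimality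
  among all dependent sets.\<close>

lemma dependent_contains_circuit:
  assumes "finite S" "admissible S A" "\<nexists>B. B \<in> \<B> \<and> A \<subseteq> B"
  shows "\<exists>C\<subseteq>A. circuit S \<B> C"
proof -
  have "finite A"
    using assms finite_ground finite_subset by (auto simp: admissible_def)
  let ?D = "{A'. A' \<subseteq> A \<and> (\<nexists>B. B \<in> \<B> \<and> A' \<subseteq> B)}"
  have "finite ?D" "A \<in> ?D" using \<open>finite A\<close> assms(3) by auto
  then obtain C where C: "C \<in> ?D" "\<And>A'. A' \<in> ?D \<Longrightarrow> A' \<subseteq> C \<Longrightarrow> C = A'"
    by (meson finite_has_minimal2)
  have "circuit S \<B> C"
    unfolding circuit_def
  proof (intro conjI allI impI)
    show "admissible S C" using C(1) assms(2) admissible_subset by blast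
    show "\<nexists>B. B \<in> \<B> \<and> C \<subseteq> B" using C(1) by blast
    fix A' assume A': "admissible S A' \<and> (\<nexists>B. B \<in> \<B> \<and> A' \<subseteq> B) \<and> A' \<subseteq> C"
    then have "A' \<in> ?D" using C(1) by blast
    then show "A' = C" using C(2) A' by blast
  qed
  then show ?thesis using C(1) by blast
qed

lemma circuit_subset_eq:
  assumes "circuit S \<B> C" "circuit S \<B> C'" "C' \<subseteq> C"
  shows "C' = C"
  using assms unfolding circuit_def by blast

text \<open>Circuits are the minimal dependent sets, so they can be read off any family
  \<open>\<D>\<close> that generates the dependent sets upward, even if \<open>\<D>\<close> also
  contains non-minimal sets.\<close>

lemma circuits_eq_minimal:
  assumes adm: "\<And>D. D \<in> \<D> \<Longrightarrow> admissible S D"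
    and dep: "\<And>A. admissible S A \<Longrightarrow> (\<nexists>B. B \<in> \<B> \<and> A \<subseteq> B) \<longleftrightarrow> (\<exists>D\<in>\<D>. D \<subseteq> A)"
  shows "circuit S \<B> A \<longleftrightarrow> A \<in> \<D> \<and> (\<forall>D\<in>\<D>. D \<subseteq> A \<longrightarrow> D = A)"
proof
  assume A: "circuit S \<B> A"
  have min: "D = A" if "D \<in> \<D>" "D \<subseteq> A" for D
  proof -
    have "\<nexists>B. B \<in> \<B> \<and> D \<subseteq> B" using dep[OF adm[OF that(1)]] that(1) by auto
    with A adm[OF that(1)] that(2) show ?thesis unfolding circuit_def by simp
  qed
  obtain D where "D \<in> \<D>" "D \<subseteq> A" using A dep[of A] unfolding circuit_def by auto
  with min show "A \<in> \<D> \<and> (\<forall>D\<in>\<D>. D \<subseteq> A \<longrightarrow> D = A)" by blast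
next
  assume A: "A \<in> \<D> \<and> (\<forall>D\<in>\<D>. D \<subseteq> A \<longrightarrow> D = A)"
  show "circuit S \<B> A"
    unfolding circuit_def
  proof (intro conjI allI impI)
    show "admissible S A" using A adm by blast
    from dep[OF this] A show "\<nexists>B. B \<in> \<B> \<and> A \<subseteq> B" by auto
    fix A' assume A': "admissible S A' \<and> (\<nexists>B. B \<in> \<B> \<and> A' \<subseteq> B) \<and> A' \<subseteq> A"
    then obtain D where "D \<in> \<D>" "D \<subseteq> A'" using dep[of A'] by auto
    with A A' show "A' = A" by blast
  qed
qed

section \<open>Circuits of the minor\<close>

lemma transversal_meets_pair:
  assumes M: "orthogonal_matroid S \<B>" and e: "e \<in> ground S" and B: "B \<in> \<B>"
  shows "e \<in> B \<or> - e \<in> B"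
proof (rule ccontr)
  assume no: "\<not> ?thesis"
  have fin: "finite S" and pos: "S \<subseteq> {0<..}" and sub: "B \<subseteq> ground S"
    and disj: "B \<inter> uminus ` B = {}" and card: "card B = card S"
    using M B by (auto simp: orthogonal_matroid_def transversal_def admissible_def)
  \<comment> \<open>By admissibility \<open>abs\<close> embeds \<open>B\<close> into
    \<open>S\<close>. If \<open>B\<close> missed both \<open>e\<close> and \<open>- e\<close>, its
    \<open>card S\<close> elements would fit into \<open>S\<close> without the index of
    \<open>e\<close>.\<close>
  have "inj_on abs B"
    using disj by (auto simp: inj_on_def abs_eq_iff)
  moreover have "abs ` B \<subseteq> S - {\<bar>e\<bar>}"
    using sub pos no by (force simp: ground_def abs_eq_iff)
  moreover have "\<bar>e\<bar> \<in> S" using e pos by (force simp: ground_def)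
  ultimately have "card B < card S"
    using fin by (metis card_Diff1_less card_image card_mono finite_Diff order_le_less_trans)
  then show False using card by simp
qed

text \<open>The possible supports of projected vectors, not yet reduced to the minimal ones.
  Excluding \<open>{e}\<close> matters: it would contribute the empty set, which lies in every basis
  of the minor.\<close>

definition minor_candidates :: "int set \<Rightarrow> int set set \<Rightarrow> int \<Rightarrow> int set set" where
  "minor_candidates S \<B> e = (\<lambda>C. C - {e, - e}) ` {C. circuit S \<B> C \<and> - e \<notin> C \<and> C \<noteq> {e}}"

lemma admissible_minor_iff:
  "admissible (S - {e, - e}) A \<longleftrightarrow> admissible S A \<and> e \<notin> A \<and> - e \<notin> A"
  unfolding admissible_def ground_minor[symmetric] by blast

text \<open>For nonsingular \<open>e\<close>, dependence of \<open>A\<close> in the minor is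
  dependence of \<open>insert e A\<close> in \<open>\<B>\<close>; for singular \<open>e\<close> it
  is dependence of \<open>A\<close> itself. Both cases lead to the same condition on circuits inside
  \<open>insert e A\<close>.\<close>

lemma dependent_minor_iff:
  assumes M: "orthogonal_matroid S \<B>" and e: "e \<in> ground S"
    and A: "admissible (S - {e, - e}) A"
  shows "(\<nexists>B. B \<in> minor_bases \<B> e \<and> A \<subseteq> B) \<longleftrightarrow> (\<exists>D\<in>minor_candidates S \<B> e. D \<subseteq> A)"
proof -
  have fin: "finite S" and pos: "S \<subseteq> {0<..}" and ne: "\<B> \<noteq> {}"
    using M by (auto simp: orthogonal_matroid_def)
  \<comment> \<open>Since \<open>- 0 = 0\<close>, this is what makes \<open>e\<close> and
    \<open>- e\<close> distinct, so that \<open>{e}\<close> and \<open>insert e A\<close> are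
    admissible.\<close>
  have e0: "e \<noteq> 0" using e pos by (auto simp: ground_def)
  have admA: "admissible S A" and eA: "e \<notin> A" "- e \<notin> A"
    using A by (auto simp: admissible_minor_iff)
  have cand: "(\<exists>D\<in>minor_candidates S \<B> e. D \<subseteq> A) \<longleftrightarrow>
      (\<exists>C. circuit S \<B> C \<and> - e \<notin> C \<and> C \<noteq> {e} \<and> C \<subseteq> insert e A)"
  proof -
    have "C - {e, - e} \<subseteq> A \<longleftrightarrow> C \<subseteq> insert e A" if "- e \<notin> C" for C
      using that by blast
    moreover have "(\<exists>D\<in>minor_candidates S \<B> e. D \<subseteq> A) \<longleftrightarrow>
        (\<exists>C. circuit S \<B> C \<and> - e \<notin> C \<and> C \<noteq> {e} \<and> C - {e, - e} \<subseteq> A)"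
      unfolding minor_candidates_def bex_simps by (simp only: Bex_def mem_Collect_eq conj_assoc)
    ultimately show ?thesis by metis
  qed
  show ?thesis
  proof (cases "singular \<B> e")
    case False
    have adm: "admissible S (insert e A)"
      using admA eA e e0 by (auto simp: admissible_iff)
    have "(\<nexists>B. B \<in> minor_bases \<B> e \<and> A \<subseteq> B) \<longleftrightarrow> (\<nexists>B. B \<in> \<B> \<and> insert e A \<subseteq> B)"
    proof -
      have "minor_bases \<B> e = (\<lambda>B. B - {e}) ` {B \<in> \<B>. e \<in> B}"
        using False by (auto simp: minor_bases_def)
      moreover have "A \<subseteq> B - {e} \<longleftrightarrow> A \<subseteq> B" for B using eA by blast
      ultimately show ?thesis by auto
    qed
    also have "\<dots> \<longleftrightarrow> (\<exists>C\<subseteq>insert e A. circuit S \<B> C)"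
      using dependent_contains_circuit[OF fin adm] unfolding circuit_def by blast
    also have "\<dots> \<longleftrightarrow> (\<exists>C. circuit S \<B> C \<and> - e \<notin> C \<and> C \<noteq> {e} \<and> C \<subseteq> insert e A)"
    proof -
      \<comment> \<open>A nonsingular \<open>e\<close> lies in a basis, and \<open>- e\<close> is
        outside \<open>insert e A\<close>; hence every circuit inside \<open>insert e A\<close>
        meets both side conditions.\<close>
      have "\<not> circuit S \<B> {e}" using False by (auto simp: circuit_def singular_def)
      moreover have "- e \<notin> insert e A" using eA e0 by auto
      ultimately show ?thesis by blast
    qed
    finally show ?thesis using cand by simp
  next
    case True
    have mem: "- e \<in> B" "e \<notin> B" if "B \<in> \<B>" for B
      using transversal_meets_pair[OF M e that] True that by (auto simp: singular_def)
    \<comment> \<open>No basis contains \<open>e\<close>, while the empty set lies in every basis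
      and there is one.\<close>
    have loop: "circuit S \<B> {e}"
      using mem ne e e0 by (auto simp: circuit_def admissible_iff subset_singleton_iff)
    have "(\<nexists>B. B \<in> minor_bases \<B> e \<and> A \<subseteq> B) \<longleftrightarrow> (\<nexists>B. B \<in> \<B> \<and> A \<subseteq> B)"
    proof -
      \<comment> \<open>Every basis contains \<open>- e\<close>, so passing to the minor discards no
        basis.\<close>
      have "minor_bases \<B> e = (\<lambda>B. B - {- e}) ` \<B>"
        using True mem by (auto simp: minor_bases_def)
      moreover have "A \<subseteq> B - {- e} \<longleftrightarrow> A \<subseteq> B" for B using eA by blast
      ultimately show ?thesis by auto
    qed
    also have "\<dots> \<longleftrightarrow> (\<exists>C\<subseteq>A. circuit S \<B> C)"
      using dependent_contains_circuit[OF fin admA] unfolding circuit_def by blast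
    also have "\<dots> \<longleftrightarrow> (\<exists>C. circuit S \<B> C \<and> - e \<notin> C \<and> C \<noteq> {e} \<and> C \<subseteq> insert e A)"
    proof -
      \<comment> \<open>Circuits form an antichain, so \<open>{e}\<close> is the only one through
        \<open>e\<close>; the other circuits inside \<open>insert e A\<close> already lie in
        \<open>A\<close>.\<close>
      have "e \<notin> C" if "circuit S \<B> C" "C \<noteq> {e}" for C
        using circuit_subset_eq[OF that(1) loop] that(2) by auto
      then show ?thesis using eA by blast
    qed
    finally show ?thesis using cand by simp
  qed
qed

lemma circuit_minor_iff:
  assumes M: "orthogonal_matroid S \<B>" and e: "e \<in> ground S"
  shows "circuit (S - {e, - e}) (minor_bases \<B> e) A \<longleftrightarrow>
    A \<in> minor_candidates S \<B> e \<and> (\<forall>D\<in>minor_candidates S \<B> e. D \<subseteq> A \<longrightarrow> D = A)"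
proof (rule circuits_eq_minimal[OF _ dependent_minor_iff[OF M e]])
  fix D assume "D \<in> minor_candidates S \<B> e"
  then show "admissible (S - {e, - e}) D"
    unfolding minor_candidates_def admissible_minor_iff
    by (auto simp: circuit_def intro: admissible_subset)
qed

section \<open>Supports and scaling of projected vectors\<close>

lemma support_restrict_minor:
  "support (S - {e, - e}) (restrict X (ground S - {e, - e})) = support S X - {e, - e}"
  unfolding support_def ground_minor[symmetric] by auto

text \<open>Both conditions selecting the vectors to project depend only on the support, because
  \<open>e\<close> is in the ground set; and the supports of \<open>\<C>\<close> are exactly the
  circuits.\<close>

lemma support_minor_vectors:
  assumes sig: "signature F bar S \<B> \<C>" and e: "e \<in> ground S"
  shows "support (S - {e, - e}) ` minor_vectors S \<C> e = minor_candidates S \<B> e"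
proof -
  have None_iff: "X (- e) = None \<longleftrightarrow> - e \<notin> support S X" for X :: "int \<Rightarrow> 'a option"
    using e by (simp add: support_def)
  have sup: "support S ` \<C> = {A. circuit S \<B> A}" using sig by (simp add: signature_def)
  have "minor_vectors S \<C> e = (\<lambda>X. restrict X (ground S - {e, - e})) `
      {X \<in> \<C>. - e \<notin> support S X \<and> support S X \<noteq> {e}}"
    unfolding minor_vectors_def None_iff by blast
  then have "support (S - {e, - e}) ` minor_vectors S \<C> e =
      (\<lambda>X. support S X - {e, - e}) ` {X \<in> \<C>. - e \<notin> support S X \<and> support S X \<noteq> {e}}"
    by (simp add: image_image support_restrict_minor)
  also have "\<dots> = (\<lambda>A. A - {e, - e}) ` {A \<in> support S ` \<C>. - e \<notin> A \<and> A \<noteq> {e}}"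
    by blast
  finally show ?thesis by (simp add: sup minor_candidates_def)
qed

text \<open>Used with \<open>f\<close> the support map: selecting vectors of minimal support and
  then taking supports yields the minimal supports.\<close>

lemma image_minimal:
  "f ` {x \<in> V. \<forall>y\<in>V. f y \<subseteq> f x \<longrightarrow> f y = f x} =
    {A. A \<in> f ` V \<and> (\<forall>D\<in>f ` V. D \<subseteq> A \<longrightarrow> D = A)}"
  by auto

lemma support_minor_signature:
  assumes "orthogonal_matroid S \<B>" "e \<in> ground S" "signature F bar S \<B> \<C>"
  shows "support (S - {e, - e}) ` minor_signature S \<C> e =
    {A. circuit (S - {e, - e}) (minor_bases \<B> e) A}"
  unfolding circuit_minor_iff[OF assms(1,2)] support_minor_vectors[OF assms(3,2), symmetric]
    minor_signature_def by (rule image_minimal)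

lemma support_scale: "support S (scale F bar S \<alpha> X) = support S X"
proof -
  have "mult0 F (Some a) x = None \<longleftrightarrow> x = None" for a x by (cases x) auto
  then show ?thesis by (auto simp: support_def scale_def simp del: not_None_eq)
qed

text \<open>A coordinate other than \<open>e\<close> and \<open>- e\<close> lies in \<open>S\<close>
  iff it lies in \<open>S - {e, - e}\<close>, so \<open>bar\<close> is applied at the same places
  before and after projecting.\<close>

lemma scale_restrict_minor:
  shows "scale F bar (S - {e, - e}) \<alpha> (restrict X (ground S - {e, - e})) =
    restrict (scale F bar S \<alpha> X) (ground S - {e, - e})"
  unfolding scale_def ground_minor[symmetric] by (auto simp: fun_eq_iff)

lemma signature_minor:
  assumes M: "orthogonal_matroid S \<B>" and e: "e \<in> ground S" and sig: "signature F bar S \<B> \<C>"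
  shows "signature F bar (S - {e, - e}) (minor_bases \<B> e) (minor_signature S \<C> e)"
  unfolding signature_def
proof (intro conjI ballI)
  show "minor_signature S \<C> e \<subseteq> vectors F (S - {e, - e})"
    using sig unfolding signature_def vectors_def minor_signature_def minor_vectors_def
      ground_minor[symmetric] by (auto simp: PiE_iff subset_iff split: if_splits)
  show "support (S - {e, - e}) ` minor_signature S \<C> e =
      {A. circuit (S - {e, - e}) (minor_bases \<B> e) A}"
    by (rule support_minor_signature[OF M e sig])
  fix Z \<alpha> assume Z: "Z \<in> minor_signature S \<C> e" and \<alpha>: "\<alpha> \<in> carrier F"
  then obtain X where X: "Z = restrict X (ground S - {e, - e})" "X \<in> \<C>" "X (- e) = None"
      "support S X \<noteq> {e}"
    by (auto simp: minor_signature_def minor_vectors_def)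
  have "scale F bar S \<alpha> X \<in> \<C>" using sig X(2) \<alpha> by (simp add: signature_def)
  moreover have "scale F bar S \<alpha> X (- e) = None" using X(3) e by (simp add: scale_def)
  moreover have "support S (scale F bar S \<alpha> X) \<noteq> {e}" using X(4) by (simp add: support_scale)
  ultimately have "scale F bar (S - {e, - e}) \<alpha> Z \<in> minor_vectors S \<C> e"
    unfolding X(1) scale_restrict_minor minor_vectors_def by blast
  \<comment> \<open>Scaling preserves the support, so the scaled vector inherits the minimality of
    \<open>Z\<close>.\<close>
  then show "scale F bar (S - {e, - e}) \<alpha> Z \<in> minor_signature S \<C> e"
    using Z by (simp add: minor_signature_def support_scale)
qed

section \<open>Orthogonality of projected vectors\<close>

lemma pairing_restrict_minor:
  assumes fin: "finite S" and e: "e \<in> ground S" and X: "X (- e) = None" and Y: "Y (- e) = None"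
  shows "pairing F bar (S - {e, - e}) (restrict X (ground S - {e, - e}))
      (star_vec (S - {e, - e}) (restrict Y (ground S - {e, - e})))
    = pairing F bar S X (star_vec S Y)"
proof -
  have None_r: "mult0 F x None = None" for x by (cases x) auto
  \<comment> \<open>At a dropped index, \<open>star_vec\<close> makes each term pair
    \<open>X\<close> at one of \<open>e\<close>, \<open>- e\<close> with \<open>Y\<close> at the
    other, so a factor \<open>X (- e)\<close> or \<open>Y (- e)\<close> kills it.\<close>
  have "pairing F bar S X (star_vec S Y) = pairing F bar (S - {e, - e}) X (star_vec S Y)"
    unfolding pairing_def
    by (rule sum.mono_neutral_right)
      (use fin e X Y in \<open>auto simp: star_vec_def None_r ground_def\<close>)
  \<comment> \<open>For a remaining index \<open>i\<close>, both \<open>i\<close> and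
    \<open>- i\<close> stay in the ground set of the minor, where restriction changes no
    entry.\<close>
  also have "\<dots> = pairing F bar (S - {e, - e}) (restrict X (ground S - {e, - e}))
      (star_vec (S - {e, - e}) (restrict Y (ground S - {e, - e})))"
    unfolding pairing_def star_vec_def ground_minor[symmetric]
    by (rule sum.cong) (auto simp: ground_def)
  finally show ?thesis by simp
qed

text \<open>Even if \<open>e\<close> lies in both supports, it is not in the star of the support of
  \<open>Y\<close>, as \<open>Y (- e)\<close> vanishes; and \<open>- e\<close> is not in the support
  of \<open>X\<close>. So nothing is lost, and the bound 4 passes from projections to lifts.\<close>

lemma support_inter_restrict_minor:
  assumes "X (- e) = None" "Y (- e) = None"
  shows "support (S - {e, - e}) (restrict X (ground S - {e, - e})) \<inter>
      uminus ` support (S - {e, - e}) (restrict Y (ground S - {e, - e}))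
    = support S X \<inter> uminus ` support S Y"
  using assms unfolding support_restrict_minor by (auto simp: support_def)

lemma minor_signature_lift:
  assumes "Z \<in> minor_signature S \<C> e"
  obtains X where "X \<in> \<C>" "X (- e) = None" "Z = restrict X (ground S - {e, - e})"
  using assms by (auto simp: minor_signature_def minor_vectors_def)

lemma strong_orthogonal_signature_minor:
  assumes M: "orthogonal_matroid S \<B>" and e: "e \<in> ground S"
    and str: "strong_orthogonal_signature F bar S \<B> \<C>"
  shows "strong_orthogonal_signature F bar (S - {e, - e}) (minor_bases \<B> e) (minor_signature S \<C> e)"
  unfolding strong_orthogonal_signature_def
proof (intro conjI ballI)
  have fin: "finite S" using M by (simp add: orthogonal_matroid_def)
  show "signature F bar (S - {e, - e}) (minor_bases \<B> e) (minor_signature S \<C> e)"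
    by (rule signature_minor[OF M e]) (use str in \<open>simp add: strong_orthogonal_signature_def\<close>)
  fix Z W assume "Z \<in> minor_signature S \<C> e" "W \<in> minor_signature S \<C> e"
  then show "pairing F bar (S - {e, - e}) Z (star_vec (S - {e, - e}) W) \<in> null_set F"
    using str
    by (elim minor_signature_lift)
      (simp add: pairing_restrict_minor[OF fin e] strong_orthogonal_signature_def)
qed

lemma weak_orthogonal_signature_minor:
  assumes M: "orthogonal_matroid S \<B>" and e: "e \<in> ground S"
    and weak: "weak_orthogonal_signature F bar S \<B> \<C>"
  shows "weak_orthogonal_signature F bar (S - {e, - e}) (minor_bases \<B> e) (minor_signature S \<C> e)"
  unfolding weak_orthogonal_signature_def
proof (intro conjI ballI impI)
  have fin: "finite S" using M by (simp add: orthogonal_matroid_def)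
  show "signature F bar (S - {e, - e}) (minor_bases \<B> e) (minor_signature S \<C> e)"
    by (rule signature_minor[OF M e]) (use weak in \<open>simp add: weak_orthogonal_signature_def\<close>)
  fix Z W assume "Z \<in> minor_signature S \<C> e" "W \<in> minor_signature S \<C> e"
    and "card (support (S - {e, - e}) Z \<inter> uminus ` support (S - {e, - e}) W) \<le> 4"
  then show "pairing F bar (S - {e, - e}) Z (star_vec (S - {e, - e}) W) \<in> null_set F"
    using weak
    by (elim minor_signature_lift)
      (simp add: pairing_restrict_minor[OF fin e] support_inter_restrict_minor
        weak_orthogonal_signature_def)
qed

theorem proposition3p26:
  fixes F :: "'g tract" and bar :: "'g \<Rightarrow> 'g" and n :: nat
    and \<B> :: "int set set" and \<C> :: "(int \<Rightarrow> 'g option) set" and e :: int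
  assumes "tract F" and "tract_involution F bar"
    and "orthogonal_matroid {1..int n} \<B>" and "e \<in> ground {1..int n}"
  shows "(strong_orthogonal_signature F bar {1..int n} \<B> \<C> \<longrightarrow>
            strong_orthogonal_signature F bar ({1..int n} - {e, - e}) (minor_bases \<B> e)
              (minor_signature {1..int n} \<C> e))
       \<and> (weak_orthogonal_signature F bar {1..int n} \<B> \<C> \<longrightarrow>
            weak_orthogonal_signature F bar ({1..int n} - {e, - e}) (minor_bases \<B> e)
              (minor_signature {1..int n} \<C> e))"
  using strong_orthogonal_signature_minor[OF assms(3,4)] weak_orthogonal_signature_minor[OF assms(3,4)]
  by blast

end
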